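(* Let $(\varphi_n)_{n\in\mathbb N}$ be a sequence of Young functions such that $\varphi_{k+1}(t)\le \varphi_k(t)$ and $\sum_{n=1}^\infty \varphi_n(t)=+\infty$ for each $t>0$ and $k\in\mathbb N$. For any bounded and non-empty subset $A$ of $(\Phi BV[0,1],\|\cdot\|_\Phi)$ the following conditions are equivalent: (i) $A$ is relatively compact in $(\Phi BV[0,1],\|\cdot\|_\Phi)$; (ii) for every $\varepsilon>0$ there exists a finite family $\mathcal J$ of closed subintervals of $[0,1]$ such that $|x-y|_\Phi\le\varepsilon+|x-y|_{\mathcal J}$ for all $x,y\in A$.
   Context: A Young function is a convex function $\varphi\colon[0,+\infty)\to[0,+\infty)$ such that $\varphi(t)=0$ if and only if $t=0$. Closed intervals may be degenerate (a single point). Two intervals are non-overlapping if their intersection is empty or a singleton; a collection is non-overlapping if its members are pairwise so, and the intervals in a collection are assumed distinct. For a function $x$ and an interval $I=[a,b]$ write $x(I):=x(b)-x(a)$. Let $\mathcal P$ be the family of all closed subintervals of $[0,1]$. For $\mathcal J\subseteq\mathcal P$ (whose members are allowed to overlap) and $x\colon[0,1]\to\mathbb R$ put $$V_{\mathcal J}(x):=\sup\sum_{n=1}^{m}\varphi_n(|x(I_n)|),\qquad |x|_{\mathcal J}:=\inf\{\lambda>0 : V_{\mathcal J}(x/\lambda)\le1\},$$ where the supremum is over all finite collections $I_1,\dots,I_m$ ($m\in\mathbb N$, in any order) of non-overlapping intervals belonging to $\mathcal J$ (an empty supremum is $0$). Put $\operatorname{var}_\Phi x:=V_{\mathcal P}(x)$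 (the Schramm variation) and $|x|_\Phi:=|x|_{\mathcal P}$. $\Phi BV[0,1]$ is the linear space of all $x\colon[0,1]\to\mathbb R$ such that $\operatorname{var}_\Phi(\lambda x)<+\infty$ for some $\lambda>0$; it is a Banach space with norm $\|x\|_\Phi:=|x(0)|+|x|_\Phi$. A subset of a metric space is relatively compact if its closure is compact. *)

theory Defs
  imports "HOL-Analysis.Analysis"
begin

text \<open>Only the values of \<open>\<phi>\<close> on \<open>[0,+\<infinity>)\<close> matter.\<close>

definition young_function :: "(real \<Rightarrow> real) \<Rightarrow> bool" where
  "young_function \<phi> \<longleftrightarrow>
     convex_on {0..} \<phi> \<and> (\<forall>t\<ge>0. 0 \<le> \<phi> t) \<and> (\<forall>t\<ge>0. \<phi> t = 0 \<longleftrightarrow> t = 0)"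

definition unit_subintervals :: "real set set" where
  "unit_subintervals = {{a..b} | a b. 0 \<le> a \<and> a \<le> b \<and> b \<le> 1}"

definition incr :: "(real \<Rightarrow> real) \<Rightarrow> real set \<Rightarrow> real" where
  "incr x I = x (Sup I) - x (Inf I)"

definition nonoverlapping :: "real set \<Rightarrow> real set \<Rightarrow> bool" where
  "nonoverlapping I J \<longleftrightarrow> I \<inter> J = {} \<or> is_singleton (I \<inter> J)"

text \<open>A finite collection of intervals, taken in some order, is a distinct list. The sequence
  \<open>\<phi>\<close> is indexed from \<open>0\<close>. The supremum is taken in \<open>[0,+\<infinity>]\<close>.\<close>

definition variation ::
    "(nat \<Rightarrow> real \<Rightarrow> real) \<Rightarrow> real set set \<Rightarrow> (real \<Rightarrow> real) \<Rightarrow> ennreal" where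
  "variation \<phi> \<J> x =
     (SUP Is \<in> {Is. set Is \<subseteq> \<J> \<and> distinct Is \<and> pairwise nonoverlapping (set Is)}.
        ennreal (\<Sum>n<length Is. \<phi> n \<bar>incr x (Is ! n)\<bar>))"

text \<open>Extended-valued, so that the infimum of the empty set is \<open>\<infinity>\<close>; it is finite on \<open>\<Phi>BV[0,1]\<close>.\<close>

definition luxemburg ::
    "(nat \<Rightarrow> real \<Rightarrow> real) \<Rightarrow> real set set \<Rightarrow> (real \<Rightarrow> real) \<Rightarrow> ennreal" where
  "luxemburg \<phi> \<J> x =
     (INF \<mu> \<in> {\<mu>::real. 0 < \<mu> \<and> variation \<phi> \<J> (\<lambda>t. x t / \<mu>) \<le> 1}. ennreal \<mu>)"

text \<open>Functions \<open>[0,1] \<rightarrow> \<real>\<close> are represented by functions on the reals that take the default value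
  \<open>undefined\<close> outside \<open>[0,1]\<close>. Variations, hence the norm, only see the values on \<open>[0,1]\<close>, so
  scaled functions and differences need not be restricted again.\<close>

definition PhiBV :: "(nat \<Rightarrow> real \<Rightarrow> real) \<Rightarrow> (real \<Rightarrow> real) set" where
  "PhiBV \<phi> = {x \<in> {0..1} \<rightarrow>\<^sub>E UNIV.
     \<exists>\<mu>>0. variation \<phi> unit_subintervals (\<lambda>t. \<mu> * x t) < \<infinity>}"

definition PhiBV_norm :: "(nat \<Rightarrow> real \<Rightarrow> real) \<Rightarrow> (real \<Rightarrow> real) \<Rightarrow> real" where
  "PhiBV_norm \<phi> x = \<bar>x 0\<bar> + enn2real (luxemburg \<phi> unit_subintervals x)"

definition PhiBV_dist :: "(nat \<Rightarrow> real \<Rightarrow> real) \<Rightarrow> (real \<Rightarrow> real) \<Rightarrow> (real \<Rightarrow> real) \<Rightarrow> real" where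
  "PhiBV_dist \<phi> x y = PhiBV_norm \<phi> (\<lambda>t. x t - y t)"

definition PhiBV_topology :: "(nat \<Rightarrow> real \<Rightarrow> real) \<Rightarrow> (real \<Rightarrow> real) topology" where
  "PhiBV_topology \<phi> = Metric_space.mtopology (PhiBV \<phi>) (PhiBV_dist \<phi>)"

definition relatively_compactin :: "'a topology \<Rightarrow> 'a set \<Rightarrow> bool" where
  "relatively_compactin T A \<longleftrightarrow> compactin T (T closure_of A)"

text \<open>The norm metric is a metric, so that the topology above is the intended one.\<close>

lemma young_nonneg: "young_function \<phi> \<Longrightarrow> 0 \<le> t \<Longrightarrow> 0 \<le> \<phi> t"
  by (simp add: young_function_def)

lemma young_zero: "young_function \<phi> \<Longrightarrow> \<phi> 0 = 0"
  by (simp add: young_function_def)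

lemma young_scale:
  assumes "young_function \<phi>" "0 \<le> c" "c \<le> 1" "0 \<le> t"
  shows "\<phi> (c * t) \<le> c * \<phi> t"
proof -
  have "convex_on {0..} \<phi>" using assms by (simp add: young_function_def)
  from convex_onD[OF this, of c 0 t] assms young_zero[OF assms(1)] show ?thesis by simp
qed

lemma young_mono:
  assumes "young_function \<phi>" "0 \<le> s" "s \<le> t"
  shows "\<phi> s \<le> \<phi> t"
proof (cases "t = 0")
  case False
  then have "\<phi> ((s / t) * t) \<le> (s / t) * \<phi> t"
    using assms by (intro young_scale[OF assms(1)]) auto
  also have "\<dots> \<le> 1 * \<phi> t"
    using assms False by (intro mult_right_mono young_nonneg[OF assms(1)]) auto
  finally show ?thesis using False by simp
qed (use assms in auto)

lemma young_abs_convex: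
  assumes "young_function \<phi>" "0 \<le> c" "c \<le> 1"
  shows "\<phi> \<bar>c * a + (1 - c) * b\<bar> \<le> c * \<phi> \<bar>a\<bar> + (1 - c) * \<phi> \<bar>b\<bar>"
proof -
  have cv: "convex_on {0..} \<phi>" using assms by (simp add: young_function_def)
  have "\<bar>c * a + (1 - c) * b\<bar> \<le> \<bar>c * a\<bar> + \<bar>(1 - c) * b\<bar>" by (rule abs_triangle_ineq)
  also have "\<dots> = c * \<bar>a\<bar> + (1 - c) * \<bar>b\<bar>"
    using assms by (simp add: abs_mult)
  finally have "\<phi> \<bar>c * a + (1 - c) * b\<bar> \<le> \<phi> (c * \<bar>a\<bar> + (1 - c) * \<bar>b\<bar>)"
    using assms by (intro young_mono[OF assms(1)]) auto
  also have "\<dots> \<le> c * \<phi> \<bar>a\<bar> + (1 - c) * \<phi> \<bar>b\<bar>"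
    using convex_onD[OF cv, of "1 - c" "\<bar>a\<bar>" "\<bar>b\<bar>"] assms by simp
  finally show ?thesis .
qed

lemma variation_convex:
  assumes y: "\<forall>n. young_function (\<phi> n)" and c: "0 \<le> c" "c \<le> 1"
  shows "variation \<phi> \<J> (\<lambda>t. c * x t + (1 - c) * z t)
     \<le> ennreal c * variation \<phi> \<J> x + ennreal (1 - c) * variation \<phi> \<J> z"
  unfolding variation_def[of _ _ "\<lambda>t. c * x t + (1 - c) * z t"]
proof (rule SUP_least)
  fix Is assume Is: "Is \<in> {Is. set Is \<subseteq> \<J> \<and> distinct Is \<and> pairwise nonoverlapping (set Is)}"
  let ?S = "\<lambda>x. \<Sum>n<length Is. \<phi> n \<bar>incr x (Is ! n)\<bar>"
  have nn: "0 \<le> ?S x" for x by (intro sum_nonneg young_nonneg[OF y[rule_format]]) auto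
  have le: "ennreal (?S x) \<le> variation \<phi> \<J> x" for x
    unfolding variation_def using Is by (rule SUP_upper)
  have "?S (\<lambda>t. c * x t + (1 - c) * z t) =
      (\<Sum>n<length Is. \<phi> n \<bar>c * incr x (Is ! n) + (1 - c) * incr z (Is ! n)\<bar>)"
    by (simp add: incr_def algebra_simps)
  also have "\<dots> \<le> (\<Sum>n<length Is. c * \<phi> n \<bar>incr x (Is ! n)\<bar> + (1 - c) * \<phi> n \<bar>incr z (Is ! n)\<bar>)"
    using c by (intro sum_mono young_abs_convex[OF y[rule_format]]) auto
  also have "\<dots> = c * ?S x + (1 - c) * ?S z"
    by (simp add: sum.distrib sum_distrib_left)
  finally have "ennreal (?S (\<lambda>t. c * x t + (1 - c) * z t)) \<le> ennreal (c * ?S x + (1 - c) * ?S z)"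
    by (rule ennreal_leI)
  also have "\<dots> = ennreal c * ennreal (?S x) + ennreal (1 - c) * ennreal (?S z)"
    using c nn by (simp add: ennreal_mult ennreal_plus)
  also have "\<dots> \<le> ennreal c * variation \<phi> \<J> x + ennreal (1 - c) * variation \<phi> \<J> z"
    by (intro add_mono mult_left_mono le) auto
  finally show "ennreal (?S (\<lambda>t. c * x t + (1 - c) * z t))
     \<le> ennreal c * variation \<phi> \<J> x + ennreal (1 - c) * variation \<phi> \<J> z" .
qed

lemma variation_zero:
  assumes "\<forall>n. young_function (\<phi> n)"
  shows "variation \<phi> \<J> (\<lambda>t. 0) = 0"
  unfolding variation_def
  by (rule antisym[OF SUP_least]) (simp_all add: incr_def young_zero[OF assms[rule_format]])

lemma variation_scale:
  assumes "\<forall>n. young_function (\<phi> n)" "0 \<le> c" "c \<le> 1"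
  shows "variation \<phi> \<J> (\<lambda>t. c * x t) \<le> ennreal c * variation \<phi> \<J> x"
  using variation_convex[OF assms, of \<J> x "\<lambda>t. 0"] by (simp add: variation_zero[OF assms(1)])

lemma variation_minus: "variation \<phi> \<J> (\<lambda>t. - x t) = variation \<phi> \<J> x"
proof -
  have "incr (\<lambda>t. - x t) I = - incr x I" for I by (simp add: incr_def)
  then show ?thesis by (simp add: variation_def)
qed

lemma luxemburg_minus: "luxemburg \<phi> \<J> (\<lambda>t. - x t) = luxemburg \<phi> \<J> x"
proof -
  have "variation \<phi> \<J> (\<lambda>t. - x t / l) = variation \<phi> \<J> (\<lambda>t. x t / l)" for l
    using variation_minus[of \<phi> \<J> "\<lambda>t. x t / l"] by simp
  then show ?thesis by (simp add: luxemburg_def)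
qed

lemma luxemburg_triangle:
  assumes y: "\<forall>n. young_function (\<phi> n)"
  shows "luxemburg \<phi> \<J> (\<lambda>t. x t + z t) \<le> luxemburg \<phi> \<J> x + luxemburg \<phi> \<J> z"
proof (rule ccontr)
  assume "\<not> ?thesis"
  then have less: "luxemburg \<phi> \<J> x + luxemburg \<phi> \<J> z < luxemburg \<phi> \<J> (\<lambda>t. x t + z t)" by simp
  have key: "luxemburg \<phi> \<J> (\<lambda>t. x t + z t) \<le> ennreal l + ennreal m"
    if l: "0 < l" "variation \<phi> \<J> (\<lambda>t. x t / l) \<le> 1"
      and m: "0 < m" "variation \<phi> \<J> (\<lambda>t. z t / m) \<le> 1" for l m
  proof -
    define c where "c = l / (l + m)"
    have c: "0 \<le> c" "c \<le> 1" and c': "1 - c = m / (l + m)"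
      using l m by (auto simp: c_def field_simps)
    have "(\<lambda>t. (x t + z t) / (l + m)) = (\<lambda>t. c * (x t / l) + (1 - c) * (z t / m))"
      unfolding c' using l m by (auto simp: c_def fun_eq_iff add_divide_distrib)
    then have "variation \<phi> \<J> (\<lambda>t. (x t + z t) / (l + m))
       \<le> ennreal c * variation \<phi> \<J> (\<lambda>t. x t / l) + ennreal (1 - c) * variation \<phi> \<J> (\<lambda>t. z t / m)"
      using variation_convex[OF y c, of \<J> "\<lambda>t. x t / l" "\<lambda>t. z t / m"] by simp
    also have "\<dots> \<le> ennreal c * 1 + ennreal (1 - c) * 1"
      by (intro add_mono mult_left_mono l m) auto
    also have "\<dots> = 1" using c by (simp flip: ennreal_plus)
    finally have "luxemburg \<phi> \<J> (\<lambda>t. x t + z t) \<le> ennreal (l + m)"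
      unfolding luxemburg_def using l m by (intro INF_lower) simp
    then show ?thesis using l m by simp
  qed
  have key2: "luxemburg \<phi> \<J> (\<lambda>t. x t + z t) \<le> luxemburg \<phi> \<J> x + ennreal m"
    if m: "0 < m" "variation \<phi> \<J> (\<lambda>t. z t / m) \<le> 1" for m
  proof -
    have "luxemburg \<phi> \<J> (\<lambda>t. x t + z t) - ennreal m \<le> luxemburg \<phi> \<J> x"
      unfolding luxemburg_def[of _ _ x]
    proof (rule INF_greatest)
      fix l assume "l \<in> {l. 0 < l \<and> variation \<phi> \<J> (\<lambda>t. x t / l) \<le> 1}"
      then show "luxemburg \<phi> \<J> (\<lambda>t. x t + z t) - ennreal m \<le> ennreal l"
        using key[of l m] m by (simp add: ennreal_minus_le_iff add.commute)
    qed
    then show ?thesis by (simp add: ennreal_minus_le_iff add.commute)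
  qed
  have fin: "luxemburg \<phi> \<J> x \<noteq> \<infinity>" using less by auto
  have "luxemburg \<phi> \<J> (\<lambda>t. x t + z t) - luxemburg \<phi> \<J> x \<le> luxemburg \<phi> \<J> z"
    unfolding luxemburg_def[of _ _ z]
  proof (rule INF_greatest)
    fix m assume "m \<in> {m. 0 < m \<and> variation \<phi> \<J> (\<lambda>t. z t / m) \<le> 1}"
    then show "luxemburg \<phi> \<J> (\<lambda>t. x t + z t) - luxemburg \<phi> \<J> x \<le> ennreal m"
      using key2[of m] fin by (simp add: ennreal_minus_le_iff)
  qed
  then have "luxemburg \<phi> \<J> (\<lambda>t. x t + z t) \<le> luxemburg \<phi> \<J> x + luxemburg \<phi> \<J> z"
    using fin by (simp add: ennreal_minus_le_iff)
  then show False using less by simp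
qed

lemma luxemburg_finite:
  assumes y: "\<forall>n. young_function (\<phi> n)"
    and l: "0 < l" "variation \<phi> \<J> (\<lambda>t. l * x t) < \<infinity>"
  shows "luxemburg \<phi> \<J> x < \<infinity>"
proof -
  obtain v where v: "variation \<phi> \<J> (\<lambda>t. l * x t) = ennreal v" "0 \<le> v"
    using l(2) by (cases "variation \<phi> \<J> (\<lambda>t. l * x t)") auto
  define c where "c = 1 / (v + 1)"
  have c: "0 < c" "c \<le> 1" and cv: "c * v \<le> 1" using v by (auto simp: c_def)
  have "variation \<phi> \<J> (\<lambda>t. c * (l * x t)) \<le> ennreal c * ennreal v"
    using variation_scale[OF y, of c \<J> "\<lambda>t. l * x t"] c v by simp
  also have "\<dots> = ennreal (c * v)" using c v by (simp add: ennreal_mult)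
  also have "\<dots> \<le> 1" using cv by simp
  finally have "variation \<phi> \<J> (\<lambda>t. x t / (1 / (c * l))) \<le> 1" by (simp add: mult_ac)
  then have "luxemburg \<phi> \<J> x \<le> ennreal (1 / (c * l))"
    unfolding luxemburg_def using c l by (intro INF_lower) simp
  then show ?thesis using le_less_trans ennreal_less_top by fastforce
qed

lemma luxemburg_eq_0D:
  assumes y: "\<forall>n. young_function (\<phi> n)"
    and 0: "luxemburg \<phi> unit_subintervals x = 0" and t: "t \<in> {0..1}"
  shows "x t = x 0"
proof (rule ccontr)
  assume ne: "x t \<noteq> x 0"
  define a where "a = \<bar>x t - x 0\<bar>"
  have a: "0 < a" using ne by (simp add: a_def)
  have p: "0 < \<phi> 0 1" using y unfolding young_function_def
    by (metis order_le_less zero_le_one zero_neq_one)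
  define e where "e = min a (a * \<phi> 0 1 / 2)"
  have e: "0 < e" using a p by (simp add: e_def)
  have "luxemburg \<phi> unit_subintervals x < ennreal e" using 0 e by simp
  then obtain l where l: "0 < l" "variation \<phi> unit_subintervals (\<lambda>t. x t / l) \<le> 1"
    and "ennreal l < ennreal e"
    unfolding luxemburg_def by (auto simp: INF_less_iff)
  then have le: "l < e" using e by (simp add: ennreal_less_iff)
  have inc: "incr (\<lambda>t. x t / l) {0..t} = (x t - x 0) / l"
    using t by (simp add: incr_def diff_divide_distrib)
  have "ennreal (\<Sum>n<length [{0..t}]. \<phi> n \<bar>incr (\<lambda>t. x t / l) ([{0..t}] ! n)\<bar>)
      \<le> variation \<phi> unit_subintervals (\<lambda>t. x t / l)"
    unfolding variation_def using t
    by (intro SUP_upper) (auto simp: unit_subintervals_def)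
  then have "ennreal (\<phi> 0 (a / l)) \<le> variation \<phi> unit_subintervals (\<lambda>t. x t / l)"
    using l inc by (simp add: a_def)
  also have "\<dots> \<le> 1" by (rule l)
  finally have "ennreal (\<phi> 0 (a / l)) \<le> 1" .
  then have le1: "\<phi> 0 (a / l) \<le> 1" by simp
  have al: "1 \<le> a / l" using l le by (simp add: e_def)
  have "\<phi> 0 ((l / a) * (a / l)) \<le> (l / a) * \<phi> 0 (a / l)"
    using l a al by (intro young_scale[OF y[rule_format]]) (auto simp: field_simps)
  also have "\<dots> \<le> (l / a) * 1" using l a le1 by (intro mult_left_mono) auto
  finally have "\<phi> 0 1 \<le> l / a" using l a by simp
  also have "\<dots> < e / a" using le a by (simp add: divide_strict_right_mono)
  also have "\<dots> \<le> (a * \<phi> 0 1 / 2) / a" using a by (intro divide_right_mono) (auto simp: e_def)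
  also have "\<dots> = \<phi> 0 1 / 2" using a by simp
  finally show False using p by simp
qed

lemma Metric_space_PhiBV:
  assumes y: "\<forall>n. young_function (\<phi> n)"
  shows "Metric_space (PhiBV \<phi>) (PhiBV_dist \<phi>)"
proof
  let ?L = "luxemburg \<phi> unit_subintervals"
  have diff: "?L (\<lambda>t. x t - z t) \<le> ?L x + ?L z" for x z
    using luxemburg_triangle[OF y, of unit_subintervals x "\<lambda>t. - z t"]
    by (simp add: luxemburg_minus)
  have fin: "?L x < \<infinity>" if "x \<in> PhiBV \<phi>" for x
    using that luxemburg_finite[OF y] by (auto simp: PhiBV_def)
  have findiff: "?L (\<lambda>t. x t - z t) < \<infinity>" if "x \<in> PhiBV \<phi>" "z \<in> PhiBV \<phi>" for x z
    using le_less_trans[OF diff[of x z]] fin[OF that(1)] fin[OF that(2)] by simp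
  fix x z w
  show "0 \<le> PhiBV_dist \<phi> x z" by (simp add: PhiBV_dist_def PhiBV_norm_def)
  show "PhiBV_dist \<phi> x z = PhiBV_dist \<phi> z x"
    using luxemburg_minus[of \<phi> unit_subintervals "\<lambda>t. x t - z t"]
    by (simp add: PhiBV_dist_def PhiBV_norm_def abs_minus_commute)
  assume x: "x \<in> PhiBV \<phi>" and z: "z \<in> PhiBV \<phi>"
  show "PhiBV_dist \<phi> x z = 0 \<longleftrightarrow> x = z"
  proof
    assume "PhiBV_dist \<phi> x z = 0"
    then have n: "\<bar>x 0 - z 0\<bar> + enn2real (?L (\<lambda>t. x t - z t)) = 0"
      by (simp add: PhiBV_dist_def PhiBV_norm_def)
    then have x0: "x 0 = z 0" and "enn2real (?L (\<lambda>t. x t - z t)) = 0"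
      using enn2real_nonneg[of "?L (\<lambda>t. x t - z t)"] by linarith+
    then have "?L (\<lambda>t. x t - z t) = 0"
      using findiff[OF x z] by (auto simp: enn2real_eq_0_iff)
    from luxemburg_eq_0D[OF y this] x0 have "x t = z t" if "t \<in> {0..1}" for t
      using that by fastforce
    then show "x = z" using x z by (intro PiE_ext[of x "{0..1}" "\<lambda>_. UNIV" z]) (auto simp: PhiBV_def)
  next
    assume "x = z"
    moreover have "?L (\<lambda>t. 0) = 0"
    proof -
      have "?L (\<lambda>t. 0) \<le> 0 + ennreal e" if "0 < e" for e
        unfolding luxemburg_def using that by (simp add: INF_lower variation_zero[OF y])
      then show ?thesis using ennreal_le_epsilon[of 0 "?L (\<lambda>t. 0)"] by auto
    qed
    ultimately show "PhiBV_dist \<phi> x z = 0" by (simp add: PhiBV_dist_def PhiBV_norm_def)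
  qed
  assume w: "w \<in> PhiBV \<phi>"
  have "?L (\<lambda>t. x t - w t) \<le> ?L (\<lambda>t. x t - z t) + ?L (\<lambda>t. z t - w t)"
    using luxemburg_triangle[OF y, of unit_subintervals "\<lambda>t. x t - z t" "\<lambda>t. z t - w t"] by simp
  then have "enn2real (?L (\<lambda>t. x t - w t))
      \<le> enn2real (?L (\<lambda>t. x t - z t) + ?L (\<lambda>t. z t - w t))"
    using findiff[OF x z] findiff[OF z w] by (intro enn2real_mono) auto
  also have "\<dots> = enn2real (?L (\<lambda>t. x t - z t)) + enn2real (?L (\<lambda>t. z t - w t))"
    using findiff[OF x z] findiff[OF z w] by (intro enn2real_plus) auto
  finally show "PhiBV_dist \<phi> x w \<le> PhiBV_dist \<phi> x z + PhiBV_dist \<phi> z w"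
    by (simp add: PhiBV_dist_def PhiBV_norm_def)
qed

end

theory Submission
  imports Defs
begin

text \<open>A single function \<open>z\<close> of finite norm satisfies \<open>|z|\<^sub>\<Phi> \<le> \<epsilon> + |z|\<^sub>\<J>\<close> for some finite \<open>\<J>\<close>:
  for \<open>\<mu> = |z|\<^sub>\<Phi> - \<epsilon>\<close> the variation of \<open>z / \<mu>\<close> exceeds \<open>1\<close>, so it already exceeds \<open>1\<close> on one finite
  collection of intervals. Taking the union of these families over the differences of points of a
  finite net gives (ii) from total boundedness. Conversely, \<open>|z|\<^sub>\<J>\<close> with \<open>\<J>\<close> finite is controlled
  by the values of \<open>z\<close> at the finitely many endpoints, where a norm-bounded set is bounded, so (ii)
  gives total boundedness. As \<open>\<Phi>BV\<close> is complete, by lower semicontinuity of the seminorm under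
  pointwise convergence, total boundedness amounts to relative compactness.\<close>

section \<open>Monotonicity in the family of intervals, continuity, finite nets for bounded
  values\<close>

lemma variation_mono_family:
  assumes "\<J> \<subseteq> \<K>"
  shows "variation \<phi> \<J> x \<le> variation \<phi> \<K> x"
  unfolding variation_def using assms by (intro SUP_subset_mono) auto

lemma luxemburg_mono_family:
  assumes "\<J> \<subseteq> \<K>"
  shows "luxemburg \<phi> \<J> x \<le> luxemburg \<phi> \<K> x"
  unfolding luxemburg_def
  using order_trans[OF variation_mono_family[OF assms]] by (intro INF_superset_mono) auto

lemma luxemburg_leI:
  assumes "0 < r" "variation \<phi> \<J> (\<lambda>t. x t / r) \<le> 1"
  shows "luxemburg \<phi> \<J> x \<le> ennreal r"
  unfolding luxemburg_def using assms by (intro INF_lower) simp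

lemma incr_divide: "incr (\<lambda>t. x t / c) I = incr x I / c"
  by (simp add: incr_def diff_divide_distrib)

text \<open>The even extension of a Young function is convex on the whole line, so 0 becomes an
  interior point and convexity alone yields continuity everywhere.\<close>

lemma young_continuous_abs:
  assumes "young_function f"
  shows "continuous_on UNIV (\<lambda>u. f \<bar>u\<bar>)"
proof (rule convex_on_continuous[OF open_UNIV], rule convex_onI)
  fix c a b :: real assume "0 < c" "c < 1"
  then show "f \<bar>(1 - c) *\<^sub>R a + c *\<^sub>R b\<bar> \<le> (1 - c) * f \<bar>a\<bar> + c * f \<bar>b\<bar>"
    using young_abs_convex[OF assms, of "1 - c" a b] by simp
qed auto

text \<open>Values are rounded down to multiples of \<delta>. Boundedness leaves only finitely many
  rounding patterns on \<open>E\<close>, and one representative in \<open>A\<close> of each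
  occurring pattern gives the net.\<close>

lemma finite_net_of_bounded_values:
  fixes g :: "'a \<Rightarrow> 'b \<Rightarrow> real"
  assumes E: "finite E" and B: "\<And>x t. x \<in> A \<Longrightarrow> t \<in> E \<Longrightarrow> \<bar>g x t\<bar> \<le> B" and d: "0 < \<delta>"
  shows "\<exists>K. finite K \<and> K \<subseteq> A \<and> (\<forall>x\<in>A. \<exists>y\<in>K. \<forall>t\<in>E. \<bar>g y t - g x t\<bar> \<le> \<delta>)"
proof -
  define h where "h x = (\<lambda>t\<in>E. \<lfloor>g x t / \<delta>\<rfloor>)" for x
  have "h x \<in> (\<Pi>\<^sub>E t\<in>E. {\<lfloor>- B / \<delta>\<rfloor>..\<lfloor>B / \<delta>\<rfloor>})" if "x \<in> A" for x
  proof -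
    have "\<lfloor>- B / \<delta>\<rfloor> \<le> \<lfloor>g x t / \<delta>\<rfloor> \<and> \<lfloor>g x t / \<delta>\<rfloor> \<le> \<lfloor>B / \<delta>\<rfloor>" if "t \<in> E" for t
      using B[OF \<open>x \<in> A\<close> that] d by (intro conjI floor_mono divide_right_mono) auto
    then show ?thesis by (auto simp: h_def)
  qed
  then have "h ` A \<subseteq> (\<Pi>\<^sub>E t\<in>E. {\<lfloor>- B / \<delta>\<rfloor>..\<lfloor>B / \<delta>\<rfloor>})" by blast
  then have "finite (h ` A)" by (rule finite_subset) (intro finite_PiE E finite_atLeastAtMost_int)
  then obtain K where K: "finite K" "K \<subseteq> A" "h ` A = h ` K"
    using finite_subset_image[of "h ` A" h A] by blast
  have "\<exists>y\<in>K. \<forall>t\<in>E. \<bar>g y t - g x t\<bar> \<le> \<delta>" if "x \<in> A" for x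
  proof -
    have "h x \<in> h ` K" using K(3) that by blast
    then obtain y where y: "y \<in> K" "h y = h x" by (metis imageE)
    have "\<bar>g y t - g x t\<bar> \<le> \<delta>" if "t \<in> E" for t
    proof -
      have "\<lfloor>g y t / \<delta>\<rfloor> = \<lfloor>g x t / \<delta>\<rfloor>" using fun_cong[OF y(2), of t] that by (simp add: h_def)
      then have "\<bar>g y t / \<delta> - g x t / \<delta>\<bar> \<le> 1" by linarith
      then show ?thesis using d by (simp flip: diff_divide_distrib)
    qed
    then show ?thesis using y(1) by blast
  qed
  then show ?thesis using K by blast
qed

section \<open>Luxemburg seminorms for a fixed sequence of Young functions\<close>

context
  fixes \<phi> :: "nat \<Rightarrow> real \<Rightarrow> real"
  assumes young: "\<forall>n. young_function (\<phi> n)"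
begin

text \<open>Convexity and the value 0 at 0 make the variation shrink at least by the factor
  \<open>l / m\<close>. Thus the scales competing in the infimum form an upward closed set.\<close>

lemma variation_divide_le_1_mono:
  assumes "0 < l" "l \<le> m" "variation \<phi> \<J> (\<lambda>t. x t / l) \<le> 1"
  shows "variation \<phi> \<J> (\<lambda>t. x t / m) \<le> 1"
proof -
  have "variation \<phi> \<J> (\<lambda>t. (l / m) * (x t / l)) \<le> ennreal (l / m) * variation \<phi> \<J> (\<lambda>t. x t / l)"
    using assms by (intro variation_scale[OF young]) auto
  also have "\<dots> \<le> 1 * 1"
    using assms by (intro mult_mono) auto
  finally show ?thesis using assms by simp
qed

text \<open>Some admissible scale lies below \<open>r\<close>, and admissibility passes to larger
  scales. The strict inequality avoids asking whether the infimum is attained.\<close>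

lemma luxemburg_lessD:
  assumes "luxemburg \<phi> \<J> x < ennreal r"
  shows "variation \<phi> \<J> (\<lambda>t. x t / r) \<le> 1"
proof -
  obtain l where "0 < l" "variation \<phi> \<J> (\<lambda>t. x t / l) \<le> 1" "ennreal l < ennreal r"
    using assms unfolding luxemburg_def by (auto simp: INF_less_iff)
  then show ?thesis
    using variation_divide_le_1_mono[of l r] by (simp add: ennreal_less_iff)
qed

lemma luxemburg_ge:
  assumes "\<not> variation \<phi> \<J> (\<lambda>t. x t / r) \<le> 1"
  shows "ennreal r \<le> luxemburg \<phi> \<J> x"
  by (rule leI) (use luxemburg_lessD assms in blast)

lemma luxemburg_diff_commute:
  "luxemburg \<phi> \<J> (\<lambda>t. x t - y t) = luxemburg \<phi> \<J> (\<lambda>t. y t - x t)"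
  using luxemburg_minus[of \<phi> \<J> "\<lambda>t. x t - y t"] by simp

lemma luxemburg_diff_triangle:
  "luxemburg \<phi> \<J> (\<lambda>t. x t - w t)
    \<le> luxemburg \<phi> \<J> (\<lambda>t. x t - y t) + luxemburg \<phi> \<J> (\<lambda>t. y t - w t)"
  using luxemburg_triangle[OF young, of \<J> "\<lambda>t. x t - y t" "\<lambda>t. y t - w t"] by simp

lemma luxemburg_PhiBV_finite:
  assumes "x \<in> PhiBV \<phi>"
  shows "luxemburg \<phi> unit_subintervals x < \<infinity>"
  using assms luxemburg_finite[OF young] by (auto simp: PhiBV_def)

lemma luxemburg_PhiBV_diff_finite:
  assumes "x \<in> PhiBV \<phi>" "y \<in> PhiBV \<phi>"
  shows "luxemburg \<phi> unit_subintervals (\<lambda>t. x t - y t) < \<infinity>"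
proof -
  have "luxemburg \<phi> unit_subintervals (\<lambda>t. x t - y t)
      \<le> luxemburg \<phi> unit_subintervals x + luxemburg \<phi> unit_subintervals y"
    using luxemburg_triangle[OF young, of unit_subintervals x "\<lambda>t. - y t"]
    by (simp add: luxemburg_minus)
  also have "\<dots> < \<infinity>" using assms by (simp add: luxemburg_PhiBV_finite[simplified])
  finally show ?thesis .
qed

section \<open>Pointwise bounds, lower semicontinuity and completeness\<close>

lemma in_PhiBV_iff:
  "x \<in> PhiBV \<phi> \<longleftrightarrow> x \<in> {0..1} \<rightarrow>\<^sub>E UNIV \<and> luxemburg \<phi> unit_subintervals x < \<infinity>"
proof
  assume R: "x \<in> {0..1} \<rightarrow>\<^sub>E UNIV \<and> luxemburg \<phi> unit_subintervals x < \<infinity>"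
  obtain r where "luxemburg \<phi> unit_subintervals x < ennreal r" "0 < r"
  proof (cases "luxemburg \<phi> unit_subintervals x")
    case (real v)
    \<comment> \<open>Any real above \<open>v\<close> serves: it is then an admissible scale, and
      its inverse is the multiplier required for membership.\<close>
    then show thesis using that[of "v + 1"] by (simp add: ennreal_less_iff)
  qed (use R in auto)
  then have "variation \<phi> unit_subintervals (\<lambda>t. (1 / r) * x t) < \<infinity>"
    using luxemburg_lessD[of unit_subintervals x r]
    by (simp add: le_less_trans[OF _ ennreal_one_less_top])
  then show "x \<in> PhiBV \<phi>"
    using R \<open>0 < r\<close> unfolding PhiBV_def by (intro CollectI conjI exI[of _ "1 / r"]) auto
next
  assume "x \<in> PhiBV \<phi>"
  then show "x \<in> {0..1} \<rightarrow>\<^sub>E UNIV \<and> luxemburg \<phi> unit_subintervals x < \<infinity>"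
    using luxemburg_PhiBV_finite by (simp add: PhiBV_def)
qed

text \<open>The one-interval collection \<open>{0..t}\<close> already gives
  \<open>\<phi> 0 (\<bar>x t - x 0\<bar> / r) \<le> 1\<close> for an admissible scale
  \<open>r\<close>, and by convexity \<open>\<phi> 0\<close> grows at least linearly beyond 1. Hence
  the seminorm controls the values uniformly on [0,1] once the value at 0 is known.\<close>

lemma value_bound:
  obtains K where "0 < K"
    "\<And>x r t. luxemburg \<phi> unit_subintervals x \<le> ennreal r \<Longrightarrow> 0 \<le> r \<Longrightarrow> t \<in> {0..1} \<Longrightarrow> \<bar>x t - x 0\<bar> \<le> K * r"
proof -
  have p: "0 < \<phi> 0 1"
    using young unfolding young_function_def by (metis order_le_less zero_le_one zero_neq_one)
  \<comment> \<open>The entry 1 serves increments of size at most \<open>r\<close>, the entry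
    \<open>1 / \<phi> 0 1\<close> the larger ones.\<close>
  define K where "K = max 1 (1 / \<phi> 0 1)"
  have K: "1 \<le> K" "1 / \<phi> 0 1 \<le> K" by (auto simp: K_def)
  have strict: "\<bar>x t - x 0\<bar> \<le> K * r"
    if L: "luxemburg \<phi> unit_subintervals x < ennreal r" and t: "t \<in> {0..1}" for x r t
  proof -
    define a where "a = \<bar>x t - x 0\<bar>"
    have r: "0 < r" using L by (cases "0 < r") (auto simp: ennreal_neg)
    have "ennreal (\<Sum>n<length [{0..t}]. \<phi> n \<bar>incr (\<lambda>t. x t / r) ([{0..t}] ! n)\<bar>)
        \<le> variation \<phi> unit_subintervals (\<lambda>t. x t / r)"
      unfolding variation_def using t by (intro SUP_upper) (auto simp: unit_subintervals_def)
    also have "\<dots> \<le> 1" by (rule luxemburg_lessD[OF L])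
    finally have le1: "\<phi> 0 (a / r) \<le> 1"
      using r t by (simp add: incr_def a_def flip: diff_divide_distrib)
    show ?thesis
    proof (cases "a \<le> r")
      case True
      also have "r \<le> K * r" using K r by simp
      finally show ?thesis by (simp add: a_def)
    next
      case False
      have "\<phi> 0 ((r / a) * (a / r)) \<le> (r / a) * \<phi> 0 (a / r)"
        using r False by (intro young_scale[OF young[rule_format]]) (auto simp: field_simps)
      also have "\<dots> \<le> (r / a) * 1" using r False le1 by (intro mult_left_mono) auto
      finally have "a \<le> (1 / \<phi> 0 1) * r" using r False p by (simp add: field_simps)
      also have "\<dots> \<le> K * r" using K r by (intro mult_right_mono) auto
      finally show ?thesis by (simp add: a_def)
    qed
  qed
  show thesis
  proof
    show "0 < K" using K by simp
    fix x r t assume L: "luxemburg \<phi> unit_subintervals x \<le> ennreal r" "0 \<le> r" and t: "t \<in> {0..1::real}"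
    have "\<bar>x t - x 0\<bar> / K \<le> r"
    \<comment> \<open>Only scales strictly above the seminorm are known to be admissible, so the
      bound is proved for every \<open>s > r\<close> and then carried over to
      \<open>r\<close>.\<close>
    proof (rule dense_ge)
      fix s assume "r < s"
      then have "luxemburg \<phi> unit_subintervals x < ennreal s"
        using L by (meson ennreal_lessI le_less_trans)
      from strict[OF this t] show "\<bar>x t - x 0\<bar> / K \<le> s" using \<open>0 < K\<close> by (simp add: field_simps)
    qed
    then show "\<bar>x t - x 0\<bar> \<le> K * r" using \<open>0 < K\<close> by (simp add: field_simps)
  qed
qed

text \<open>For a fixed finite collection the sum depends continuously on the values at finitely
  many endpoints, so the bound 1 survives pointwise limits; then the supremum is taken. The
  endpoints lie in [0,1], where convergence is assumed.\<close>

lemma variation_lower_semicontinuous: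
  assumes \<J>: "\<J> \<subseteq> unit_subintervals"
    and lim: "\<And>t. t \<in> {0..1} \<Longrightarrow> (\<lambda>k. X k t) \<longlonglongrightarrow> x t"
    and le: "\<forall>\<^sub>F k in sequentially. variation \<phi> \<J> (X k) \<le> 1"
  shows "variation \<phi> \<J> x \<le> 1"
  unfolding variation_def
proof (rule SUP_least)
  fix Is assume Is: "Is \<in> {Is. set Is \<subseteq> \<J> \<and> distinct Is \<and> pairwise nonoverlapping (set Is)}"
  let ?S = "\<lambda>x. \<Sum>n<length Is. \<phi> n \<bar>incr x (Is ! n)\<bar>"
  have "(\<lambda>k. \<phi> n \<bar>incr (X k) (Is ! n)\<bar>) \<longlonglongrightarrow> \<phi> n \<bar>incr x (Is ! n)\<bar>" if "n < length Is" for n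
  proof -
    have "Is ! n \<in> unit_subintervals" using Is \<J> nth_mem[OF that] by blast
    then have "Inf (Is ! n) \<in> {0..1}" "Sup (Is ! n) \<in> {0..1}"
      by (auto simp: unit_subintervals_def)
    then have "(\<lambda>k. incr (X k) (Is ! n)) \<longlonglongrightarrow> incr x (Is ! n)"
      unfolding incr_def by (intro tendsto_intros lim)
    then show ?thesis
      using continuous_on_tendsto_compose[OF young_continuous_abs[OF young[rule_format]]] by simp
  qed
  then have "(\<lambda>k. ?S (X k)) \<longlonglongrightarrow> ?S x" by (intro tendsto_sum) auto
  moreover have "\<forall>\<^sub>F k in sequentially. ?S (X k) \<le> 1"
    using le
  proof eventually_elim
    case (elim k)
    have "ennreal (?S (X k)) \<le> variation \<phi> \<J> (X k)"
      unfolding variation_def using Is by (rule SUP_upper)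
    then have "ennreal (?S (X k)) \<le> 1" using elim by (rule order_trans)
    then show ?case by simp
  qed
  ultimately have "?S x \<le> 1" by (intro tendsto_upperbound[of _ _ sequentially]) auto
  then show "ennreal (?S x) \<le> 1" by simp
qed

lemma luxemburg_lower_semicontinuous:
  assumes \<J>: "\<J> \<subseteq> unit_subintervals"
    and lim: "\<And>t. t \<in> {0..1} \<Longrightarrow> (\<lambda>k. X k t) \<longlonglongrightarrow> x t"
    and le: "\<forall>\<^sub>F k in sequentially. luxemburg \<phi> \<J> (X k) < ennreal r" and r: "0 < r"
  shows "luxemburg \<phi> \<J> x \<le> ennreal r"
proof (rule luxemburg_leI[OF r], rule variation_lower_semicontinuous[OF \<J>])
  show "(\<lambda>k. X k t / r) \<longlonglongrightarrow> x t / r" if "t \<in> {0..1}" for t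
    using r by (intro tendsto_intros lim that) auto
  show "\<forall>\<^sub>F k in sequentially. variation \<phi> \<J> (\<lambda>t. X k t / r) \<le> 1"
    using le by eventually_elim (rule luxemburg_lessD)
qed

lemma PhiBV_dist_leI:
  assumes "\<bar>x 0 - y 0\<bar> \<le> a" "luxemburg \<phi> unit_subintervals (\<lambda>t. x t - y t) \<le> ennreal b" "0 \<le> b"
  shows "PhiBV_dist \<phi> x y \<le> a + b"
  unfolding PhiBV_dist_def PhiBV_norm_def
  using assms enn2real_mono[OF assms(2)] by simp

lemma luxemburg_less_of_dist_less:
  assumes "x \<in> PhiBV \<phi>" "y \<in> PhiBV \<phi>" "PhiBV_dist \<phi> x y < e"
  shows "luxemburg \<phi> unit_subintervals (\<lambda>t. x t - y t) < ennreal e"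
proof -
  have "enn2real (luxemburg \<phi> unit_subintervals (\<lambda>t. x t - y t)) < e"
    using assms(3) by (simp add: PhiBV_dist_def PhiBV_norm_def)
  then show ?thesis
    using luxemburg_PhiBV_diff_finite[OF assms(1,2)]
    by (cases "luxemburg \<phi> unit_subintervals (\<lambda>t. x t - y t)") (auto simp: ennreal_less_iff)
qed

interpretation PhiBV: Metric_space "PhiBV \<phi>" "PhiBV_dist \<phi>"
  by (rule Metric_space_PhiBV[OF young])

text \<open>A Cauchy sequence in norm is Cauchy at every point of [0,1], which supplies the
  candidate limit. Lower semicontinuity turns the Cauchy estimates into convergence in norm.\<close>

lemma mcomplete_PhiBV: "Metric_space.mcomplete (PhiBV \<phi>) (PhiBV_dist \<phi>)"
  unfolding PhiBV.mcomplete_def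
proof (intro allI impI)
  fix X assume "PhiBV.MCauchy X"
  then have X: "\<And>k. X k \<in> PhiBV \<phi>"
    and Cauchy: "\<And>e. 0 < e \<Longrightarrow> \<exists>N. \<forall>m\<ge>N. \<forall>n\<ge>N. PhiBV_dist \<phi> (X m) (X n) < e"
    by (auto simp: PhiBV.MCauchy_def)
  obtain K where K: "0 < K" and vals:
    "\<And>x r t. luxemburg \<phi> unit_subintervals x \<le> ennreal r \<Longrightarrow> 0 \<le> r \<Longrightarrow> t \<in> {0..1} \<Longrightarrow> \<bar>x t - x 0\<bar> \<le> K * r"
    by (rule value_bound) blast
  have "convergent (\<lambda>k. X k t)" if t: "t \<in> {0..1}" for t
  proof (rule Cauchy_convergent, rule CauchyI)
    fix e :: real assume e: "0 < e"
    \<comment> \<open>The difference at \<open>t\<close> deviates by at most \<open>K * d\<close>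
      from the difference at 0, which is below \<open>d\<close>; \<open>K + 2\<close> leaves some
      slack.\<close>
    define d where "d = e / (K + 2)"
    have d: "0 < d" using e K by (simp add: d_def)
    obtain N where N: "\<forall>m\<ge>N. \<forall>n\<ge>N. PhiBV_dist \<phi> (X m) (X n) < d" using Cauchy[OF d] by blast
    have "norm (X m t - X n t) < e" if "N \<le> m" "N \<le> n" for m n
    proof -
      have dist: "PhiBV_dist \<phi> (X m) (X n) < d" using N that by blast
      then have 0: "\<bar>X m 0 - X n 0\<bar> < d"
        unfolding PhiBV_dist_def PhiBV_norm_def
        using enn2real_nonneg[of "luxemburg \<phi> unit_subintervals (\<lambda>t. X m t - X n t)"] by linarith
      have "\<bar>(X m t - X n t) - (X m 0 - X n 0)\<bar> \<le> K * d"
        using vals[OF less_imp_le[OF luxemburg_less_of_dist_less[OF X X dist]] _ t] d by simp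
      then have "\<bar>X m t - X n t\<bar> < K * d + 2 * d" using 0 d by linarith
      also have "\<dots> = (K + 2) * d" by (simp add: distrib_right)
      also have "\<dots> = e" using K by (simp add: d_def)
      finally show ?thesis by simp
    qed
    then show "\<exists>M. \<forall>m\<ge>M. \<forall>n\<ge>M. norm (X m t - X n t) < e" by blast
  qed
  \<comment> \<open>The restriction gives the default value outside [0,1] that membership in
    \<open>PhiBV\<close> demands.\<close>
  define x where "x = (\<lambda>t\<in>{0..1}. lim (\<lambda>k. X k t))"
  have lim: "(\<lambda>k. X k t) \<longlonglongrightarrow> x t" if "t \<in> {0..1}" for t
    using \<open>\<And>t. t \<in> {0..1} \<Longrightarrow> convergent (\<lambda>k. X k t)\<close>[OF that] that
    by (simp add: x_def convergent_LIMSEQ_iff)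
  have tail: "\<exists>N. \<forall>n\<ge>N. \<bar>X n 0 - x 0\<bar> \<le> e \<and>
      luxemburg \<phi> unit_subintervals (\<lambda>t. X n t - x t) \<le> ennreal e" if e: "0 < e" for e
  proof -
    obtain N where N: "\<forall>m\<ge>N. \<forall>n\<ge>N. PhiBV_dist \<phi> (X m) (X n) < e" using Cauchy[OF e] by blast
    have "luxemburg \<phi> unit_subintervals (\<lambda>t. X n t - x t) \<le> ennreal e" if n: "N \<le> n" for n
    \<comment> \<open>Here \<open>n\<close> is fixed and \<open>X n - X k\<close> tends pointwise to
      \<open>X n - x\<close> as \<open>k\<close> grows.\<close>
    proof (rule luxemburg_lower_semicontinuous[OF order_refl _ _ e])
      show "(\<lambda>k. X n t - X k t) \<longlonglongrightarrow> X n t - x t" if "t \<in> {0..1}" for t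
        by (intro tendsto_intros lim that)
      show "\<forall>\<^sub>F k in sequentially. luxemburg \<phi> unit_subintervals (\<lambda>t. X n t - X k t) < ennreal e"
        using eventually_ge_at_top[of N]
        by eventually_elim (use N n in \<open>auto intro!: luxemburg_less_of_dist_less X\<close>)
    qed
    moreover obtain N' where "\<forall>n\<ge>N'. \<bar>X n 0 - x 0\<bar> < e"
      using LIMSEQ_D[OF lim[of 0] e] by auto
    ultimately show ?thesis by (intro exI[of _ "max N N'"]) (auto intro: less_imp_le)
  qed
  have x: "x \<in> PhiBV \<phi>"
    unfolding in_PhiBV_iff
  proof
    obtain n where "luxemburg \<phi> unit_subintervals (\<lambda>t. X n t - x t) \<le> ennreal 1"
      using tail[of 1] by auto
    \<comment> \<open>The limit is split as \<open>x = - (X n - x) + X n\<close>, two summands of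
      finite seminorm.\<close>
    then have "luxemburg \<phi> unit_subintervals (\<lambda>t. - (X n t - x t)) + luxemburg \<phi> unit_subintervals (X n) < \<infinity>"
      using luxemburg_PhiBV_finite[OF X[of n]] unfolding luxemburg_minus
      by (auto simp: le_less_trans[OF _ ennreal_one_less_top])
    then show "luxemburg \<phi> unit_subintervals x < \<infinity>"
      using le_less_trans[OF luxemburg_triangle[OF young, of _ "\<lambda>t. - (X n t - x t)" "X n"]] by simp
  qed (simp add: x_def)
  have "\<exists>N. \<forall>n\<ge>N. X n \<in> PhiBV \<phi> \<and> PhiBV_dist \<phi> (X n) x < e" if "0 < e" for e
  proof -
    obtain N where N: "\<forall>n\<ge>N. \<bar>X n 0 - x 0\<bar> \<le> e / 3 \<and>
        luxemburg \<phi> unit_subintervals (\<lambda>t. X n t - x t) \<le> ennreal (e / 3)"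
      using tail[of "e / 3"] \<open>0 < e\<close> by auto
    have "PhiBV_dist \<phi> (X n) x \<le> e / 3 + e / 3" if "N \<le> n" for n
      using N that \<open>0 < e\<close> by (intro PhiBV_dist_leI) auto
    moreover have "e / 3 + e / 3 < e" using \<open>0 < e\<close> by simp
    ultimately have "\<forall>n\<ge>N. PhiBV_dist \<phi> (X n) x < e" by (meson le_less_trans)
    then show ?thesis using X by blast
  qed
  then show "\<exists>x. limitin PhiBV.mtopology X x sequentially"
    using x by (auto simp: PhiBV.limit_metric_sequentially)
qed

section \<open>Seminorms over finite families\<close>

lemma luxemburg_finite_subfamily:
  assumes "luxemburg \<phi> \<K> z < \<infinity>" and e: "0 < e"
  obtains \<J> where "finite \<J>" "\<J> \<subseteq> \<K>" "luxemburg \<phi> \<K> z \<le> ennreal e + luxemburg \<phi> \<J> z"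
proof (cases "luxemburg \<phi> \<K> z \<le> ennreal e")
  case True
  \<comment> \<open>A seminorm of at most \<open>e\<close> is absorbed by \<open>e\<close> itself,
    so the empty family suffices. In the other case \<open>m\<close> below is positive.\<close>
  then show thesis using that[of "{}"] by (simp add: add_increasing2)
next
  case False
  obtain v where v: "luxemburg \<phi> \<K> z = ennreal v" "0 \<le> v"
    using assms(1) by (cases "luxemburg \<phi> \<K> z") auto
  define m where "m = v - e"
  have m: "0 < m" "m < v" using False v e by (auto simp: m_def)
  have "\<not> variation \<phi> \<K> (\<lambda>t. z t / m) \<le> 1"
    using luxemburg_leI[of m \<phi> \<K> z] m v by auto
  then obtain Is where Is: "set Is \<subseteq> \<K>" "distinct Is" "pairwise nonoverlapping (set Is)"
    and gt: "1 < ennreal (\<Sum>n<length Is. \<phi> n \<bar>incr (\<lambda>t. z t / m) (Is ! n)\<bar>)"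
    unfolding variation_def by (auto simp: not_le less_SUP_iff)
  \<comment> \<open>The list \<open>Is\<close> also competes in the supremum over its own members,
    so \<open>m\<close> remains inadmissible for the finite family \<open>set Is\<close>.\<close>
  have "ennreal (\<Sum>n<length Is. \<phi> n \<bar>incr (\<lambda>t. z t / m) (Is ! n)\<bar>)
      \<le> variation \<phi> (set Is) (\<lambda>t. z t / m)"
    unfolding variation_def using Is by (intro SUP_upper) auto
  then have "ennreal m \<le> luxemburg \<phi> (set Is) z"
    using less_le_trans[OF gt] by (intro luxemburg_ge) (simp add: not_le)
  then have "ennreal e + ennreal m \<le> ennreal e + luxemburg \<phi> (set Is) z"
    by (rule add_left_mono)
  moreover have "ennreal e + ennreal m = luxemburg \<phi> \<K> z"
    using m e v by (simp add: m_def flip: ennreal_plus)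
  ultimately show thesis using that[of "set Is"] Is by simp
qed

text \<open>A distinct list from \<open>\<J>\<close> has at most \<open>card \<J>\<close> entries,
  and every \<open>\<phi> n\<close> is dominated by \<open>\<phi> 0\<close>. Uniformly small
  increments therefore keep every competing sum at most 1.\<close>

lemma luxemburg_finite_family_small:
  assumes decreasing: "\<And>k t. 0 < t \<Longrightarrow> \<phi> (Suc k) t \<le> \<phi> k t"
    and \<J>: "finite \<J>" and e: "0 < e"
  obtains \<delta> where "0 < \<delta>"
    "\<And>z. (\<And>I. I \<in> \<J> \<Longrightarrow> \<bar>incr z I\<bar> \<le> \<delta>) \<Longrightarrow> luxemburg \<phi> \<J> z \<le> ennreal e"
proof -
  have p: "0 \<le> \<phi> 0 1" by (simp add: young young_nonneg)
  have le0: "\<phi> n s \<le> \<phi> 0 s" if "0 \<le> s" for n s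
  proof (cases "s = 0")
    case False
    then have "0 < s" using that by simp
    then show ?thesis by (induction n) (auto intro: order_trans[OF decreasing])
  qed (simp add: young young_zero)
  have pc: "0 < real (card \<J>) * \<phi> 0 1 + 1" "0 \<le> real (card \<J>) * \<phi> 0 1"
    using p by (simp_all add: add_nonneg_pos)
  \<comment> \<open>With this \<open>c\<close>, \<open>card \<J>\<close> terms of size at most
    \<open>c * \<phi> 0 1\<close> add up to at most 1. The summand 1 keeps the denominator positive
    for empty \<open>\<J>\<close> and gives \<open>c \<le> 1\<close>, as scaling by convexity
    requires.\<close>
  define c where "c = 1 / (real (card \<J>) * \<phi> 0 1 + 1)"
  have c: "0 < c" "c \<le> 1" "real (card \<J>) * (c * \<phi> 0 1) \<le> 1"
    unfolding c_def using pc by (simp_all add: pos_divide_le_eq)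
  show thesis
  proof
    show "0 < c * e" using c e by simp
    fix z assume z: "\<And>I. I \<in> \<J> \<Longrightarrow> \<bar>incr z I\<bar> \<le> c * e"
    have "variation \<phi> \<J> (\<lambda>t. z t / e) \<le> 1"
      unfolding variation_def
    proof (rule SUP_least)
      fix Is assume "Is \<in> {Is. set Is \<subseteq> \<J> \<and> distinct Is \<and> pairwise nonoverlapping (set Is)}"
      then have Is: "set Is \<subseteq> \<J>" "distinct Is" by auto
      have "\<phi> n \<bar>incr (\<lambda>t. z t / e) (Is ! n)\<bar> \<le> c * \<phi> 0 1" if "n < length Is" for n
      proof -
        have "\<bar>incr z (Is ! n)\<bar> \<le> c * e" using Is nth_mem[OF that] by (intro z) blast
        then have "\<bar>incr (\<lambda>t. z t / e) (Is ! n)\<bar> \<le> c"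
          using e by (simp add: incr_divide field_simps)
        then have "\<phi> 0 \<bar>incr (\<lambda>t. z t / e) (Is ! n)\<bar> \<le> \<phi> 0 (c * 1)"
          using c by (intro young_mono[OF young[rule_format]]) auto
        also have "\<dots> \<le> c * \<phi> 0 1" using c by (intro young_scale[OF young[rule_format]]) auto
        finally show ?thesis using le0[of "\<bar>incr (\<lambda>t. z t / e) (Is ! n)\<bar>" n] by simp
      qed
      then have "(\<Sum>n<length Is. \<phi> n \<bar>incr (\<lambda>t. z t / e) (Is ! n)\<bar>) \<le> (\<Sum>n<length Is. c * \<phi> 0 1)"
        by (intro sum_mono) auto
      also have "\<dots> = real (card (set Is)) * (c * \<phi> 0 1)" using Is by (simp add: distinct_card)
      also have "\<dots> \<le> real (card \<J>) * (c * \<phi> 0 1)"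
        using Is \<J> c p by (intro mult_right_mono of_nat_mono card_mono) auto
      also have "\<dots> \<le> 1" by (rule c)
      finally show "ennreal (\<Sum>n<length Is. \<phi> n \<bar>incr (\<lambda>t. z t / e) (Is ! n)\<bar>) \<le> 1" by simp
    qed
    then show "luxemburg \<phi> \<J> z \<le> ennreal e" by (rule luxemburg_leI[OF e])
  qed
qed

section \<open>The two implications between total boundedness and condition (ii)\<close>

lemma finite_family_of_mtotally_bounded:
  assumes tb: "PhiBV.mtotally_bounded A" and e: "0 < e"
  obtains \<J> where "finite \<J>" "\<J> \<subseteq> unit_subintervals"
    "\<And>x y. x \<in> A \<Longrightarrow> y \<in> A \<Longrightarrow> luxemburg \<phi> unit_subintervals (\<lambda>t. x t - y t)
        \<le> ennreal e + luxemburg \<phi> \<J> (\<lambda>t. x t - y t)"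
proof -
  let ?U = "unit_subintervals"
  let ?L = "\<lambda>\<J> x y. luxemburg \<phi> \<J> (\<lambda>t. x t - y t)"
  \<comment> \<open>Five errors occur: two for replacing \<open>x\<close>, \<open>y\<close> by net
    points \<open>u\<close>, \<open>v\<close> in the full seminorm, one for passing to the finite
    family, and two for returning to \<open>x\<close>, \<open>y\<close> there.\<close>
  define d where "d = e / 5"
  have d: "0 < d" using e by (simp add: d_def)
  have "\<exists>K. finite K \<and> K \<subseteq> A \<and> A \<subseteq> (\<Union>x\<in>K. PhiBV.mball x d)"
    using tb d by (simp add: PhiBV.mtotally_bounded_def)
  then obtain K where K: "finite K" "K \<subseteq> A" "A \<subseteq> (\<Union>x\<in>K. PhiBV.mball x d)"
    by (elim exE conjE)
  have KP: "x \<in> PhiBV \<phi>" if "x \<in> K" for x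
    using that K(2) PhiBV.mtotally_bounded_imp_subset[OF tb] by blast
  have "\<exists>\<J>. finite \<J> \<and> \<J> \<subseteq> ?U \<and> ?L ?U x y \<le> ennreal d + ?L \<J> x y" if "x \<in> K" "y \<in> K" for x y
    using luxemburg_finite_subfamily[OF luxemburg_PhiBV_diff_finite[OF KP KP] d] that by metis
  then obtain F where F: "\<And>x y. x \<in> K \<Longrightarrow> y \<in> K \<Longrightarrow>
      finite (F x y) \<and> F x y \<subseteq> ?U \<and> ?L ?U x y \<le> ennreal d + ?L (F x y) x y"
    by metis
  \<comment> \<open>One finite family for all pairs of net points, hence independent of
    \<open>x\<close> and \<open>y\<close>.\<close>
  define \<J> where "\<J> = (\<Union>x\<in>K. \<Union>y\<in>K. F x y)"
  have \<J>: "\<J> \<subseteq> ?U" using F by (auto simp: \<J>_def)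
  show thesis
  proof
    show "finite \<J>" using K F by (auto simp: \<J>_def)
    fix x y assume "x \<in> A" "y \<in> A"
    then obtain u v where u: "u \<in> K" "x \<in> PhiBV.mball u d" and v: "v \<in> K" "y \<in> PhiBV.mball v d"
      using K(3) by blast
    have ux: "?L ?U u x \<le> ennreal d" and vy: "?L ?U v y \<le> ennreal d"
      using u v by (auto intro!: less_imp_le[OF luxemburg_less_of_dist_less])
    have "?L ?U x y \<le> ?L ?U x u + (?L ?U u v + ?L ?U v y)"
      by (rule order_trans[OF luxemburg_diff_triangle add_left_mono[OF luxemburg_diff_triangle]])
    also have "\<dots> \<le> ennreal d + (?L ?U u v + ennreal d)"
      using ux vy by (intro add_mono order_refl) (simp_all add: luxemburg_diff_commute[of _ x u])
    finally have xy: "?L ?U x y \<le> ennreal d + (?L ?U u v + ennreal d)" .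
    have "?L (F u v) u v \<le> ?L \<J> u v"
      using u v by (intro luxemburg_mono_family) (auto simp: \<J>_def)
    then have uv: "?L ?U u v \<le> ennreal d + ?L \<J> u v"
      using F[OF u(1) v(1)] by (meson add_left_mono order_trans)
    \<comment> \<open>Return from the net to \<open>x\<close>, \<open>y\<close>: seminorms over
      \<open>\<J>\<close> are dominated by those over all subintervals, so the net errors stay at
      most \<open>d\<close>.\<close>
    have "?L \<J> u v \<le> ?L \<J> u x + (?L \<J> x y + ?L \<J> y v)"
      by (rule order_trans[OF luxemburg_diff_triangle add_left_mono[OF luxemburg_diff_triangle]])
    also have "\<dots> \<le> ennreal d + (?L \<J> x y + ennreal d)"
      using order_trans[OF luxemburg_mono_family[OF \<J>] ux] order_trans[OF luxemburg_mono_family[OF \<J>] vy]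
      by (intro add_mono order_refl) (simp_all add: luxemburg_diff_commute[of _ y v])
    finally have uv': "?L \<J> u v \<le> ennreal d + (?L \<J> x y + ennreal d)" .
    have "?L ?U x y \<le> ennreal d + (ennreal d + (ennreal d + (?L \<J> x y + ennreal d)) + ennreal d)"
      by (rule order_trans[OF xy add_left_mono[OF add_right_mono[OF order_trans[OF uv add_left_mono[OF uv']]]]])
    also have "\<dots> = (ennreal d + ennreal d + ennreal d + ennreal d + ennreal d) + ?L \<J> x y"
      by (simp only: ac_simps)
    also have "ennreal d + ennreal d + ennreal d + ennreal d + ennreal d = ennreal e"
      using d by (simp add: d_def flip: ennreal_plus)
    finally show "?L ?U x y \<le> ennreal e + ?L \<J> x y" .
  qed (rule \<J>)
qed

lemma mtotally_bounded_of_finite_families: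
  assumes decreasing: "\<And>k t. 0 < t \<Longrightarrow> \<phi> (Suc k) t \<le> \<phi> k t"
    and A: "A \<subseteq> PhiBV \<phi>" and C: "\<And>x. x \<in> A \<Longrightarrow> PhiBV_norm \<phi> x \<le> C"
    and fam: "\<And>e. 0 < e \<Longrightarrow> \<exists>\<J>. finite \<J> \<and> \<J> \<subseteq> unit_subintervals \<and>
        (\<forall>x\<in>A. \<forall>y\<in>A. luxemburg \<phi> unit_subintervals (\<lambda>t. x t - y t)
            \<le> ennreal e + luxemburg \<phi> \<J> (\<lambda>t. x t - y t))"
  shows "PhiBV.mtotally_bounded A"
  unfolding PhiBV.mtotally_bounded_def
proof (intro allI impI)
  fix e :: real assume e: "0 < e"
  \<comment> \<open>The distance to the net will be at most \<open>3 * d\<close>: one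
    \<open>d\<close> each for the value at 0, for condition (ii) and for the seminorm over
    \<open>\<J>\<close>. The fourth makes the inequality strict.\<close>
  define d where "d = e / 4"
  have d: "0 < d" using e by (simp add: d_def)
  obtain \<J> where \<J>: "finite \<J>" "\<J> \<subseteq> unit_subintervals"
    and le: "\<And>x y. x \<in> A \<Longrightarrow> y \<in> A \<Longrightarrow> luxemburg \<phi> unit_subintervals (\<lambda>t. x t - y t)
            \<le> ennreal d + luxemburg \<phi> \<J> (\<lambda>t. x t - y t)"
    using fam[OF d] by blast
  obtain \<delta> where \<delta>: "0 < \<delta>"
    and small: "\<And>z. (\<And>I. I \<in> \<J> \<Longrightarrow> \<bar>incr z I\<bar> \<le> \<delta>) \<Longrightarrow> luxemburg \<phi> \<J> z \<le> ennreal d"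
    using luxemburg_finite_family_small[OF decreasing \<J>(1) d] by blast
  \<comment> \<open>The point 0 is included because the norm also contains the value there.\<close>
  define E where "E = insert 0 (Inf ` \<J> \<union> Sup ` \<J>)"
  have E: "finite E" "E \<subseteq> {0..1}"
    using \<J> by (auto simp: E_def unit_subintervals_def)
  obtain M where M: "0 < M" and vals:
    "\<And>x r t. luxemburg \<phi> unit_subintervals x \<le> ennreal r \<Longrightarrow> 0 \<le> r \<Longrightarrow> t \<in> {0..1} \<Longrightarrow> \<bar>x t - x 0\<bar> \<le> M * r"
    by (rule value_bound) blast
  have B: "\<bar>x t\<bar> \<le> C + M * C" if "x \<in> A" "t \<in> E" for x t
  proof -
    define r where "r = enn2real (luxemburg \<phi> unit_subintervals x)"
    have r: "0 \<le> r" "luxemburg \<phi> unit_subintervals x = ennreal r"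
      using luxemburg_PhiBV_finite[of x] A that by (auto simp: r_def less_top)
    have norm: "\<bar>x 0\<bar> + r \<le> C" using C[OF that(1)] by (simp add: PhiBV_norm_def r_def)
    have "\<bar>x t - x 0\<bar> \<le> M * r" using vals[of x r t] r that E by auto
    also have "\<dots> \<le> M * C" using M norm by (intro mult_left_mono) auto
    finally show ?thesis using norm r by linarith
  qed
  \<comment> \<open>An increment of \<open>y - x\<close> involves two endpoint values, hence the
    half of \<delta>; the bound \<open>d\<close> is for the value at 0.\<close>
  define \<eta> where "\<eta> = min d (\<delta> / 2)"
  have \<eta>: "0 < \<eta>" "\<eta> \<le> d" "2 * \<eta> \<le> \<delta>" using d \<delta> by (auto simp: \<eta>_def)
  have "\<exists>K. finite K \<and> K \<subseteq> A \<and> (\<forall>x\<in>A. \<exists>y\<in>K. \<forall>t\<in>E. \<bar>y t - x t\<bar> \<le> \<eta>)"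
    by (rule finite_net_of_bounded_values[where g = "\<lambda>x. x", OF E(1) _ \<eta>(1)]) (rule B)
  then obtain K where K: "finite K" "K \<subseteq> A"
    and net: "\<And>x. x \<in> A \<Longrightarrow> \<exists>y\<in>K. \<forall>t\<in>E. \<bar>y t - x t\<bar> \<le> \<eta>"
    by blast
  have "A \<subseteq> (\<Union>x\<in>K. PhiBV.mball x e)"
  proof
    fix x assume x: "x \<in> A"
    then obtain y where y: "y \<in> K" "\<forall>t\<in>E. \<bar>y t - x t\<bar> \<le> \<eta>" using net by blast
    have "\<bar>incr (\<lambda>t. y t - x t) I\<bar> \<le> \<delta>" if "I \<in> \<J>" for I
    proof -
      have "\<bar>y (Inf I) - x (Inf I)\<bar> \<le> \<eta>" "\<bar>y (Sup I) - x (Sup I)\<bar> \<le> \<eta>"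
        using y(2) that by (auto simp: E_def)
      then show ?thesis using \<eta>(3) unfolding incr_def by linarith
    qed
    then have "luxemburg \<phi> \<J> (\<lambda>t. y t - x t) \<le> ennreal d" by (rule small)
    then have "luxemburg \<phi> unit_subintervals (\<lambda>t. y t - x t) \<le> ennreal d + ennreal d"
      using le[of y x] x y K by (meson add_left_mono order_trans subsetD)
    also have "\<dots> = ennreal (2 * d)" using d by (simp flip: ennreal_plus)
    finally have "luxemburg \<phi> unit_subintervals (\<lambda>t. y t - x t) \<le> ennreal (2 * d)" .
    moreover have "\<bar>y 0 - x 0\<bar> \<le> d" using y(2) \<eta>(2) by (force simp: E_def)
    ultimately have "PhiBV_dist \<phi> y x \<le> d + 2 * d" using d by (intro PhiBV_dist_leI) auto
    then have "PhiBV_dist \<phi> y x < e" using e by (simp add: d_def)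
    then show "x \<in> (\<Union>x\<in>K. PhiBV.mball x e)" using x y K A by auto
  qed
  then show "\<exists>K. finite K \<and> K \<subseteq> A \<and> A \<subseteq> (\<Union>x\<in>K. PhiBV.mball x e)" using K by blast
qed

lemma relatively_compactin_PhiBV_iff:
  assumes "A \<subseteq> PhiBV \<phi>"
  shows "relatively_compactin (PhiBV_topology \<phi>) A \<longleftrightarrow> PhiBV.mtotally_bounded A"
  using PhiBV.mtotally_bounded_eq_compact_closure_of[OF mcomplete_PhiBV] assms
  by (simp add: relatively_compactin_def PhiBV_topology_def)

end

theorem theorem4:
  fixes \<phi> :: "nat \<Rightarrow> real \<Rightarrow> real" and A :: "(real \<Rightarrow> real) set"
  assumes young: "\<And>n. young_function (\<phi> n)"
    and decreasing: "\<And>k t. 0 < t \<Longrightarrow> \<phi> (Suc k) t \<le> \<phi> k t"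
    and divergent: "\<And>t. 0 < t \<Longrightarrow> (\<Sum>n. ennreal (\<phi> n t)) = \<infinity>"
    and subset: "A \<subseteq> PhiBV \<phi>"
    and nonempty: "A \<noteq> {}"
    and bounded: "\<exists>C. \<forall>x\<in>A. PhiBV_norm \<phi> x \<le> C"
  shows "relatively_compactin (PhiBV_topology \<phi>) A \<longleftrightarrow>
    (\<forall>\<epsilon>::real. 0 < \<epsilon> \<longrightarrow>
      (\<exists>\<J>. finite \<J> \<and> \<J> \<subseteq> unit_subintervals \<and>
        (\<forall>x\<in>A. \<forall>y\<in>A.
          luxemburg \<phi> unit_subintervals (\<lambda>t. x t - y t)
            \<le> ennreal \<epsilon> + luxemburg \<phi> \<J> (\<lambda>t. x t - y t))))"
proof -
  have y: "\<forall>n. young_function (\<phi> n)" using young by blast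
  note iff = relatively_compactin_PhiBV_iff[OF y subset]
  obtain C where C: "\<And>x. x \<in> A \<Longrightarrow> PhiBV_norm \<phi> x \<le> C" using bounded by blast
  show ?thesis
    unfolding iff
  proof (intro iffI allI impI)
    fix \<epsilon> :: real
    assume "Metric_space.mtotally_bounded (PhiBV \<phi>) (PhiBV_dist \<phi>) A" "0 < \<epsilon>"
    from finite_family_of_mtotally_bounded[OF y this]
    show "\<exists>\<J>. finite \<J> \<and> \<J> \<subseteq> unit_subintervals \<and>
        (\<forall>x\<in>A. \<forall>y\<in>A. luxemburg \<phi> unit_subintervals (\<lambda>t. x t - y t)
            \<le> ennreal \<epsilon> + luxemburg \<phi> \<J> (\<lambda>t. x t - y t))"
      by metis
  qed (rule mtotally_bounded_of_finite_families[OF y decreasing subset C], auto)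
qed

end
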